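(* Let $X$ and $Y$ be compact Hausdorff spaces and let $h: Y \to \mathcal V(X)$ be a continuous function. Then the subspace $$Z = \{(y, x) \in Y \times X \mid x \in h(y)\}$$ of $Y \times X$ is compact and Hausdorff. In particular, $h$ is of the form $\mathcal V(g)\circ f^* \circ i$, where $f: Z \to Y$ and $g: Z \to X$ are the restrictions to $Z$ of the projections to $Y$ and $X$, respectively.
   Context: For a compact Hausdorff space $X$, the Vietoris space $\mathcal V(X)$ is the set of all closed subsets of $X$ (including $\emptyset$), with the topology generated by the sets $\Diamond U = \{C \in \mathcal V(X) \mid C \cap U \neq \emptyset\}$ and $\Box U = \{C \in \mathcal V(X) \mid C \subseteq U\}$, where $U$ ranges over all open subsets of $X$. For continuous maps $f: Z \to Y$ and $g: Z \to X$ of compact Hausdorff spaces, $f^*: \mathcal V(Y) \to \mathcal V(Z)$ is the inverse image map $C \mapsto f^{-1}(C)$, and $\mathcal V(g): \mathcal V(Z) \to \mathcal V(X)$ is the forward image map $C \mapsto g[C]$. The map $i: Y \to \mathcal V(Y)$ is $y \mapsto \{y\}$. *)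

theory Defs
  imports "HOL-Analysis.Analysis"
begin

definition vietoris_diamond :: "'a topology \<Rightarrow> 'a set \<Rightarrow> 'a set set" where
  "vietoris_diamond X U = {C. closedin X C \<and> C \<inter> U \<noteq> {}}"

definition vietoris_box :: "'a topology \<Rightarrow> 'a set \<Rightarrow> 'a set set" where
  "vietoris_box X U = {C. closedin X C \<and> C \<subseteq> U}"

(* No carrier has to be specified: the box of the whole space is the set of
   all closed subsets, see topspace_vietoris. *)
definition vietoris :: "'a topology \<Rightarrow> 'a set topology" where
  "vietoris X = topology_generated_by
     ({vietoris_diamond X U |U. openin X U} \<union> {vietoris_box X U |U. openin X U})"

lemma topspace_vietoris: "topspace (vietoris X) = {C. closedin X C}"
proof -
  have "vietoris_box X (topspace X) = {C. closedin X C}"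
    using closedin_subset by (auto simp: vietoris_box_def)
  moreover have "vietoris_diamond X U \<subseteq> {C. closedin X C}"
    "vietoris_box X U \<subseteq> {C. closedin X C}" for U
    by (auto simp: vietoris_diamond_def vietoris_box_def)
  ultimately show ?thesis
    unfolding vietoris_def topology_generated_by_topspace
    using openin_topspace by blast
qed

definition vietoris_map :: "('c \<Rightarrow> 'a) \<Rightarrow> 'c set \<Rightarrow> 'a set" where
  "vietoris_map g C = g ` C"

definition vietoris_preimage :: "'c topology \<Rightarrow> ('c \<Rightarrow> 'b) \<Rightarrow> 'b set \<Rightarrow> 'c set" where
  "vietoris_preimage Z f C = {z \<in> topspace Z. f z \<in> C}"

definition vietoris_unit :: "'b \<Rightarrow> 'b set" where
  "vietoris_unit y = {y}"

lemma vietoris_map_in_vietoris: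
  assumes "compact_space Z" "Hausdorff_space X" "continuous_map Z X g"
    and "C \<in> topspace (vietoris Z)"
  shows "vietoris_map g C \<in> topspace (vietoris X)"
  using assms continuous_imp_closed_map[of Z X g]
  by (auto simp: topspace_vietoris vietoris_map_def closed_map_def)

lemma vietoris_preimage_in_vietoris:
  assumes "continuous_map Z Y f" and "C \<in> topspace (vietoris Y)"
  shows "vietoris_preimage Z f C \<in> topspace (vietoris Z)"
  using assms closedin_continuous_map_preimage[of Z Y f C]
  by (auto simp: topspace_vietoris vietoris_preimage_def)

lemma vietoris_unit_in_vietoris:
  assumes "Hausdorff_space Y" and "y \<in> topspace Y"
  shows "vietoris_unit y \<in> topspace (vietoris Y)"
  using assms closedin_Hausdorff_singleton[of Y y]
  by (auto simp: topspace_vietoris vietoris_unit_def)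

end

theory Submission
  imports Defs
begin

lemma openin_vietoris_box: "openin X U \<Longrightarrow> openin (vietoris X) (vietoris_box X U)"
  unfolding vietoris_def by (rule topology_generated_by_Basis) blast

text \<open>
  The graph of \<open>h\<close> is closed: if \<open>x \<notin> h y\<close>, regularity of \<open>X\<close> gives disjoint open \<open>U \<ni> x\<close>
  and \<open>V \<supseteq> h y\<close>, and then \<open>{y'. h y' \<subseteq> V} \<times> U\<close> is a neighbourhood of \<open>(y, x)\<close> missing the graph.
\<close>
lemma closedin_graph_vietoris:
  assumes reg: "regular_space X" and h: "continuous_map Y (vietoris X) h"
  shows "closedin (prod_topology Y X) {(y, x). y \<in> topspace Y \<and> x \<in> topspace X \<and> x \<in> h y}"
    (is "closedin _ ?G")
proof -
  have "\<exists>T. openin (prod_topology Y X) T \<and> p \<in> T \<and> T \<subseteq> topspace (prod_topology Y X) - ?G"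
    if p: "p \<in> topspace (prod_topology Y X) - ?G" for p
  proof -
    obtain y x where yx: "p = (y, x)" "y \<in> topspace Y" "x \<in> topspace X" "x \<notin> h y"
      using p by auto
    \<comment> \<open>Points of \<open>vietoris X\<close> are closed sets of \<open>X\<close>, and
      \<open>h\<close> maps \<open>topspace Y\<close> into that carrier.\<close>
    have cl: "closedin X (h y)"
      using continuous_map_image_subset_topspace[OF h] yx(2) by (auto simp: topspace_vietoris)
    obtain U V where UV: "openin X U" "openin X V" "x \<in> U" "h y \<subseteq> V" "disjnt U V"
      using reg cl yx unfolding regular_space_def by (metis DiffI)
    define W where "W = {y' \<in> topspace Y. h y' \<in> vietoris_box X V}"
    have "openin Y W"
      unfolding W_def using h openin_vietoris_box[OF UV(2)] by (rule openin_continuous_map_preimage)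
    then have "openin (prod_topology Y X) (W \<times> U)"
      using UV(1) by (simp add: openin_prod_Times_iff)
    moreover have "p \<in> W \<times> U"
      using yx UV cl by (simp add: W_def vietoris_box_def)
    \<comment> \<open>A graph point \<open>(y', x')\<close> in \<open>W \<times> U\<close> would
      have \<open>x' \<in> h y' \<subseteq> V\<close> and \<open>x' \<in> U\<close>, against
      disjointness.\<close>
    moreover have "W \<times> U \<subseteq> topspace (prod_topology Y X) - ?G"
      using UV openin_subset[OF UV(1)] by (auto simp: W_def vietoris_box_def disjnt_iff)
    ultimately show ?thesis by blast
  qed
  then have "openin (prod_topology Y X) (topspace (prod_topology Y X) - ?G)"
    by (subst openin_subopen) blast
  then show ?thesis
    by (auto simp: closedin_def)
qed

text \<open>Off \<open>topspace Y\<close> the values of \<open>h\<close> are arbitrary, hence the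
  bounded quantifier; \<open>restrict\<close> makes \<open>f\<close> and \<open>g\<close>
  \<open>undefined\<close> off \<open>Z\<close>.\<close>

theorem proposition3p3:
  fixes X :: "'a topology" and Y :: "'b topology" and h :: "'b \<Rightarrow> 'a set"
  assumes "compact_space X" and "Hausdorff_space X"
    and "compact_space Y" and "Hausdorff_space Y"
    and "continuous_map Y (vietoris X) h"
  shows "let Z = subtopology (prod_topology Y X)
                   {(y, x). y \<in> topspace Y \<and> x \<in> topspace X \<and> x \<in> h y};
             f = restrict fst (topspace Z);
             g = restrict snd (topspace Z)
         in compact_space Z \<and> Hausdorff_space Z \<and>
            continuous_map Z Y f \<and> continuous_map Z X g \<and>
            (\<forall>y \<in> topspace Y. h y = (vietoris_map g \<circ> vietoris_preimage Z f \<circ> vietoris_unit) y)"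
proof -
  define G where "G = {(y, x). y \<in> topspace Y \<and> x \<in> topspace X \<and> x \<in> h y}"
  define Z where "Z = subtopology (prod_topology Y X) G"
  have topZ: "topspace Z = G"
    by (auto simp: Z_def G_def)
  \<comment> \<open>Regularity of \<open>X\<close> comes from its being compact Hausdorff.\<close>
  have "closedin (prod_topology Y X) G"
    unfolding G_def using assms
    by (intro closedin_graph_vietoris compact_Hausdorff_imp_regular_space) auto
  then have "compact_space Z"
    unfolding Z_def using assms
    by (intro compact_space_subtopology closedin_compact_space) (auto simp: compact_space_prod_topology)
  moreover have "Hausdorff_space Z"
    unfolding Z_def using assms by (simp add: Hausdorff_space_subtopology Hausdorff_space_prod_topology)
  \<comment> \<open>On \<open>topspace Z\<close> the restrictions agree with the continuous
    projections.\<close>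
  moreover have "continuous_map Z Y (restrict fst (topspace Z))"
    "continuous_map Z X (restrict snd (topspace Z))"
    by (rule continuous_map_eq[where f = fst] continuous_map_eq[where f = snd];
        simp add: Z_def continuous_map_from_subtopology continuous_map_fst continuous_map_snd)+
  \<comment> \<open>The fibre of \<open>f\<close> over \<open>y\<close> is
    \<open>{y} \<times> h y\<close>, which \<open>g\<close> projects onto
    \<open>h y\<close>.\<close>
  moreover have "h y = (vietoris_map (restrict snd (topspace Z)) \<circ>
      vietoris_preimage Z (restrict fst (topspace Z)) \<circ> vietoris_unit) y"
    if y: "y \<in> topspace Y" for y
  proof -
    have "closedin X (h y)"
      using continuous_map_image_subset_topspace[OF assms(5)] y by (auto simp: topspace_vietoris)
    \<comment> \<open>By the definition of \<open>G\<close>, the fibre a priori projects onto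
      \<open>h y \<inter> topspace X\<close>; this inclusion turns that into
      \<open>h y\<close>.\<close>
    then have "h y \<subseteq> topspace X"
      by (rule closedin_subset)
    then show ?thesis
      using y by (force simp: topZ G_def vietoris_map_def vietoris_preimage_def vietoris_unit_def)
  qed
  ultimately show ?thesis
    unfolding Let_def Z_def[symmetric] G_def[symmetric] by blast
qed

end
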